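(* Let $u\in\{\mathrm{r},\mathrm{t}\}$, let $\bar u$ be the other element of $\{\mathrm{r},\mathrm{t}\}$, and let $g_{\mathrm{fas},u}=\max\{g_u^1,\dots,g_u^{N_u}\}$, where the $g_u^n$ are Gamma distributed with parameters $m$ and $\overline g_u$ and are coupled by the Student-$t$ copula with $\nu_u>0$ degrees of freedom and correlation matrix $\mathbf{\Sigma}_u$. Let the SINRs for decoding the common and the private message be $$\gamma_{\mathrm{c},u} = \frac{\overline{\gamma}\alpha_\mathrm{c}L_uK^2g_{\mathrm{fas},u}}{\overline{\gamma}(\alpha_{\mathrm{p,r}}+\alpha_{\mathrm{p,t}})L_uK^2g_{\mathrm{fas},u}+1},\qquad \gamma_{\mathrm{p},u} = \frac{\overline{\gamma}\alpha_{\mathrm{p},u}L_uK^2g_{\mathrm{fas},u}}{\overline{\gamma}\alpha_{\mathrm{p},\bar{u}}L_uK^2g_{\mathrm{fas},u}+1}.$$ Let $\gamma_{\mathrm{th,c}}^u,\gamma_{\mathrm{th,p}}^u>0$ be thresholds with $\gamma_{\mathrm{th,c}}^u<\frac{\alpha_\mathrm{c}}{1-\alpha_\mathrm{c}}$ and $\gamma_{\mathrm{th,p}}^u<\frac{\alpha_{\mathrm{p},u}}{1-\alpha_\mathrm{c}-\alpha_{\mathrm{p},u}}$. Then the outage probability $P_{\mathrm{o},u}=1-\Pr\left(\gamma_{\mathrm{c},u}>\gamma_{\mathrm{th,c}}^u,\ \gamma_{\mathrm{p},u}>\gamma_{\mathrm{th,p}}^u\right)$ is $$P_{\mathrm{o},u}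 = T_{\nu_u,\mathbf{\Sigma}_u}\left(t_{\nu_u}^{-1}\left(\frac{1}{\Gamma(m)}\Upsilon\left(m,\frac{m\gamma_\mathrm{th}^u}{\overline{g}_u}\right)\right),\dots,t_{\nu_u}^{-1}\left(\frac{1}{\Gamma(m)}\Upsilon\left(m,\frac{m\gamma_\mathrm{th}^u}{\overline{g}_u}\right)\right)\right)$$ (with $N_u$ identical arguments), where $\gamma_{\mathrm{th}}^u=\max\{\hat{\gamma}_\mathrm{th,c}^u,\hat{\gamma}_\mathrm{th,p}^u\}$ and $$\hat{\gamma}_\mathrm{th,c}^u = \frac{\gamma_{\mathrm{th,c}}^u}{\overline{\gamma}L_uK^2\left(\alpha_\mathrm{c}-(\alpha_\mathrm{p,r}+\alpha_\mathrm{p,t})\gamma_\mathrm{th,c}^u\right)},\qquad \hat{\gamma}_\mathrm{th,p}^u = \frac{\gamma_{\mathrm{th,p}}^u}{\overline{\gamma}L_uK^2\left(\alpha_{\mathrm{p},u}-\alpha_{\mathrm{p},\bar{u}}\gamma_\mathrm{th,p}^u\right)}.$$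
   Context: Marginals. Each port gain $g_u^{n}$, $n=1,\dots,N_u$ ($N_u\ge1$), has, for $g>0$, PDF $\frac{m^m}{\Gamma(m)\overline{g}_u^m} g^{m-1}\exp(-mg/\overline{g}_u)$ and CDF $\frac{1}{\Gamma(m)}\Upsilon(m,mg/\overline{g}_u)$, where $\Gamma$ is the Gamma function and $\Upsilon(s,x)=\int_0^x z^{s-1}e^{-z}\,dz$ is the lower incomplete Gamma function. Parameters. $\overline g_u=\beta_u^2\varphi_1^2\tilde a^4$ and $m=\frac{K}{2}\cdot\frac{\varphi_1^2\tilde a^4}{1+\varphi_2-2\varphi_1^2\tilde a^4}$. Here $K\ge1$ is the number of surface (STAR-RIS) elements; $\beta_u\in(0,1]$ is the amplitude coefficient towards user $u$; $\varphi_p=\mathbb{E}[e^{jp\Theta}]=\mathcal I_p(\kappa)/\mathcal I_0(\kappa)$ are the circular moments of a zero-mean von Mises phase error $\Theta$ with concentration $\kappa>0$ ($\mathcal I_p$ is the modified Bessel function of the first kind); $\tilde a=\sqrt{a_{\mathrm b}a_u}$, where $a_{\mathrm b},a_u\in(0,1]$ are the mean magnitudes of the unit-power fading coefficients from the base station to a surface element and from a surface element to user $u$. Thus $m>0$ and $\overline g_u>0$. Dependence. $\mathbf{\Sigma}_u$ is an $N_u\times N_u$ positive definite correlation matrix. $t_\nu^{-1}$ is the quantile function of the univariate Student-$t$ distribution with $\nu$ degrees of freedom. $T_{\nu,\mathbf{\Sigma}}$ is the joint CDF of the centred multivariate Student-$t$ distribution with $\nu$ degrees of freedom and correlation (scale)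 matrix $\mathbf{\Sigma}$. The Student-$t$ copula is $C(v_1,\dots,v_d)=T_{\nu,\mathbf{\Sigma}}(t_\nu^{-1}(v_1),\dots,t_\nu^{-1}(v_d))$. That $(g_u^1,\dots,g_u^{N_u})$ has this copula means that its joint CDF is $C(F_{g_u^1}(x_1),\dots,F_{g_u^{N_u}}(x_{N_u}))$, where $F_{g_u^n}$ is the CDF of $g_u^n$. Signalling. $\overline\gamma>0$ is the average transmit SNR and $L_u>0$ is the path loss. $\alpha_\mathrm{c},\alpha_{\mathrm{p,r}},\alpha_{\mathrm{p,t}}>0$ are the power allocation factors, with $\alpha_\mathrm{c}+\alpha_{\mathrm{p,r}}+\alpha_{\mathrm{p,t}}=1$. *)

theory Defs
  imports "HOL-Probability.Probability"
begin

datatype user = Reflection | Transmission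

fun other :: "user \<Rightarrow> user" where
  "other Reflection = Transmission"
| "other Transmission = Reflection"

definition bessel_I :: "nat \<Rightarrow> real \<Rightarrow> real" where
  "bessel_I p x = (\<Sum>k. (x / 2) ^ (2 * k + p) / (fact k * fact (k + p)))"

definition von_mises :: "real \<Rightarrow> real measure" where
  "von_mises \<kappa> = density lborel
     (\<lambda>\<theta>. ennreal (indicator {-pi..pi} \<theta> * (exp (\<kappa> * cos \<theta>) / (2 * pi * bessel_I 0 \<kappa>))))"

text \<open>The circular moments of \<^const>\<open>von_mises\<close>; see \<open>von_mises_circular_moment\<close> below.\<close>

definition circ_moment :: "real \<Rightarrow> nat \<Rightarrow> real" where
  "circ_moment \<kappa> p = bessel_I p \<kappa> / bessel_I 0 \<kappa>"

definition lower_inc_gamma :: "real \<Rightarrow> real \<Rightarrow> real" where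
  "lower_inc_gamma s x = integral {0..x} (\<lambda>z. z powr (s - 1) * exp (- z))"

definition gamma_density :: "real \<Rightarrow> real \<Rightarrow> real \<Rightarrow> real" where
  "gamma_density m gbar g =
     (if g > 0 then m powr m / (Gamma m * gbar powr m) * g powr (m - 1) * exp (- m * g / gbar)
      else 0)"

definition correlation_matrix :: "real ^ 'n ^ 'n \<Rightarrow> bool" where
  "correlation_matrix S \<longleftrightarrow> transpose S = S \<and> (\<forall>i. S $ i $ i = 1)"

definition pos_definite :: "real ^ 'n ^ 'n \<Rightarrow> bool" where
  "pos_definite S \<longleftrightarrow> (\<forall>x. x \<noteq> 0 \<longrightarrow> x \<bullet> (S *v x) > 0)"

definition student_t :: "real \<Rightarrow> real measure" where
  "student_t \<nu> = density lborel
     (\<lambda>x. ennreal (Gamma ((\<nu> + 1) / 2) / (sqrt (\<nu> * pi) * Gamma (\<nu> / 2))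
                    * (1 + x\<^sup>2 / \<nu>) powr (- (\<nu> + 1) / 2)))"

definition mv_student_t :: "real \<Rightarrow> real ^ 'n ^ 'n \<Rightarrow> (real ^ 'n) measure" where
  "mv_student_t \<nu> S = density lborel
     (\<lambda>y. ennreal (Gamma ((\<nu> + real CARD('n)) / 2)
                    / (Gamma (\<nu> / 2) * (\<nu> * pi) powr (real CARD('n) / 2) * sqrt (det S))
                    * (1 + (y \<bullet> (matrix_inv S *v y)) / \<nu>) powr (- (\<nu> + real CARD('n)) / 2)))"

text \<open>Quantiles take values in the extended reals, so that the quantiles of the levels 0 and 1
  are \<open>-\<infinity>\<close> and \<open>\<infinity>\<close>; correspondingly the joint CDF accepts extended real arguments. The level 0
  does occur, as the CDF of a port gain vanishes on the nonpositive reals.\<close>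

definition student_t_quantile :: "real \<Rightarrow> real \<Rightarrow> ereal" where
  "student_t_quantile \<nu> v = (INF x \<in> {x. v \<le> cdf (student_t \<nu>) x}. ereal x)"

definition mv_student_t_cdf :: "real \<Rightarrow> real ^ 'n ^ 'n \<Rightarrow> ereal ^ 'n \<Rightarrow> real" where
  "mv_student_t_cdf \<nu> S x = measure (mv_student_t \<nu> S) {y. \<forall>i. ereal (y $ i) \<le> x $ i}"

definition student_t_copula :: "real \<Rightarrow> real ^ 'n ^ 'n \<Rightarrow> real ^ 'n \<Rightarrow> real" where
  "student_t_copula \<nu> S v = mv_student_t_cdf \<nu> S (\<chi> i. student_t_quantile \<nu> (v $ i))"

definition (in prob_space) has_copula ::
    "('n \<Rightarrow> 'a \<Rightarrow> real) \<Rightarrow> (real ^ 'n \<Rightarrow> real) \<Rightarrow> bool" where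
  "has_copula X C \<longleftrightarrow>
     (\<forall>x :: real ^ 'n. \<P>(\<omega> in M. \<forall>i. X i \<omega> \<le> x $ i) = C (\<chi> i. cdf (distr M borel (X i)) (x $ i)))"

lemma cos_power_moment:
  fixes p n :: nat
  shows "((\<lambda>\<theta>. complex_of_real (cos \<theta> ^ n) * cis (real p * \<theta>)) has_integral
     (if even (n + p) \<and> p \<le> n then complex_of_real (2 * pi * real (n choose ((n + p) div 2)) / 2 ^ n) else 0)) {-pi..pi}"
proof -
  have cis_int: "((\<lambda>\<theta>. cis (of_int q * \<theta>)) has_integral complex_of_real (if q = 0 then 2 * pi else 0)) {-pi..pi}" for q :: int
  proof (cases "q = 0")
    case True
    have "((\<lambda>\<theta>::real. 1::complex) has_integral (pi - (-pi)) *\<^sub>R 1) {-pi..pi}"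
      by (rule has_integral_const_real[THEN has_integral_eq_rhs]) auto
    then show ?thesis using True by (simp add: scaleR_conv_of_real)
  next
    case False
    have "((\<lambda>\<theta>. cis (of_int q * \<theta>)) has_integral
        (cis (of_int q * pi) / (\<i> * of_int q) - cis (of_int q * (-pi)) / (\<i> * of_int q))) {-pi..pi}"
    proof (rule fundamental_theorem_of_calculus)
      fix x :: real
      have d: "((\<lambda>\<theta>. exp (\<i> * of_real (of_int q * \<theta>))) has_vector_derivative
               (\<i> * of_int q) * exp (\<i> * of_real (of_int q * x))) (at x within {-pi..pi})"
      proof -
        have "((\<lambda>z. exp (\<i> * of_int q * z)) has_field_derivative
               (\<i> * of_int q) * exp (\<i> * of_int q * of_real x)) (at (of_real x))"
          by (auto intro!: derivative_eq_intros)
        from has_vector_derivative_real_field[OF this, of "{-pi..pi}"] show ?thesis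
          by (simp add: mult.assoc)
      qed
      show "((\<lambda>\<theta>. cis (of_int q * \<theta>) / (\<i> * of_int q)) has_vector_derivative
             cis (of_int q * x)) (at x within {-pi..pi})"
        using has_vector_derivative_divide[OF d, of "\<i> * of_int q"] False
        by (simp add: cis_conv_exp)
    qed auto
    moreover have "cis (of_int q * pi) = cis (of_int q * (-pi))"
      by (simp add: complex_eq_iff mult.commute[of _ pi] sin_integer_2pi sin_zero_iff_int2)
    ultimately show ?thesis using False by simp
  qed
  have eq: "complex_of_real (cos \<theta> ^ n) * cis (real p * \<theta>) =
    (\<Sum>j\<le>n. of_real (real (n choose j) / 2 ^ n) * cis (of_int (int n + int p - 2 * int j) * \<theta>))" for \<theta>
  proof -
    have "complex_of_real (cos \<theta>) = (cis (-\<theta>) + cis \<theta>) / 2"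
      by (simp add: complex_eq_iff)
    then have "complex_of_real (cos \<theta> ^ n) = (cis (-\<theta>) + cis \<theta>) ^ n / 2 ^ n"
      by (simp only: of_real_power power_divide)
    also have "\<dots> = (\<Sum>j\<le>n. of_nat (n choose j) * cis (-\<theta>) ^ j * cis \<theta> ^ (n - j)) / 2 ^ n"
      by (simp add: binomial_ring)
    finally have "complex_of_real (cos \<theta> ^ n) * cis (real p * \<theta>) =
       (\<Sum>j\<le>n. of_nat (n choose j) * (cis (-\<theta>) ^ j * cis \<theta> ^ (n - j) * cis (real p * \<theta>)) / 2 ^ n)"
      by (simp add: sum_distrib_right sum_divide_distrib mult.assoc)
    also have "\<dots> = (\<Sum>j\<le>n. of_real (real (n choose j) / 2 ^ n) * cis (of_int (int n + int p - 2 * int j) * \<theta>))"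
    proof (rule sum.cong[OF refl])
      fix j assume "j \<in> {..n}"
      then have "cis (-\<theta>) ^ j * cis \<theta> ^ (n - j) * cis (real p * \<theta>) = cis (of_int (int n + int p - 2 * int j) * \<theta>)"
        by (simp only: Complex.DeMoivre cis_mult) (auto simp: of_nat_diff algebra_simps intro: arg_cong[where f = cis])
      then show "of_nat (n choose j) * (cis (-\<theta>) ^ j * cis \<theta> ^ (n - j) * cis (real p * \<theta>)) / 2 ^ n =
          of_real (real (n choose j) / 2 ^ n) * cis (of_int (int n + int p - 2 * int j) * \<theta>)"
        by simp
    qed
    finally show ?thesis .
  qed
  have "((\<lambda>\<theta>. complex_of_real (cos \<theta> ^ n) * cis (real p * \<theta>)) has_integral
     (\<Sum>j\<le>n. of_real (real (n choose j) / 2 ^ n) * complex_of_real (if int n + int p - 2 * int j = 0 then 2 * pi else 0))) {-pi..pi}"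
    unfolding eq by (intro has_integral_sum has_integral_mult_right cis_int) simp
  moreover have "(\<Sum>j\<le>n. complex_of_real (real (n choose j) / 2 ^ n) * complex_of_real (if int n + int p - 2 * int j = 0 then 2 * pi else 0))
    = (if even (n + p) \<and> p \<le> n then complex_of_real (2 * pi * real (n choose ((n + p) div 2)) / 2 ^ n) else 0)"
  proof (cases "even (n + p) \<and> p \<le> n")
    case True
    have "(\<Sum>j\<le>n. complex_of_real (real (n choose j) / 2 ^ n) * complex_of_real (if int n + int p - 2 * int j = 0 then 2 * pi else 0))
       = (\<Sum>j\<le>n. if j = (n + p) div 2 then complex_of_real (2 * pi * real (n choose j) / 2 ^ n) else 0)"
      proof (intro sum.cong refl)
      fix j
      have "(int n + int p - 2 * int j = 0) \<longleftrightarrow> j = (n + p) div 2"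
        using True by presburger
      then show "complex_of_real (real (n choose j) / 2 ^ n) * complex_of_real (if int n + int p - 2 * int j = 0 then 2 * pi else 0)
        = (if j = (n + p) div 2 then complex_of_real (2 * pi * real (n choose j) / 2 ^ n) else 0)"
        by simp
    qed
    also have "\<dots> = complex_of_real (2 * pi * real (n choose ((n + p) div 2)) / 2 ^ n)"
      using True by (subst sum.delta) auto
    finally show ?thesis using True by simp
  next
    case False
    have "(int n + int p - 2 * int j = 0) = False" if "j \<le> n" for j
      using False that by presburger
    then show ?thesis unfolding if_not_P[OF False] by simp
  qed
  ultimately show ?thesis by simp
qed

lemma von_mises_integral:
  fixes p :: nat
  shows "set_integrable lborel {-pi..pi} (\<lambda>\<theta>. complex_of_real (exp (\<kappa> * cos \<theta>)) * cis (real p * \<theta>))"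
    and "(LINT \<theta>:{-pi..pi}|lborel. complex_of_real (exp (\<kappa> * cos \<theta>)) * cis (real p * \<theta>))
         = of_real (2 * pi * bessel_I p \<kappa>)"
proof -
  define f where "f n \<theta> = complex_of_real (\<kappa> ^ n / fact n) * (complex_of_real (cos \<theta> ^ n) * cis (real p * \<theta>))" for n \<theta>
  define A where "A n = (if even (n + p) \<and> p \<le> n then (2 * pi * real (n choose ((n + p) div 2)) / 2 ^ n) else 0)" for n
  have cont: "continuous_on S (f n)" for n S
    unfolding f_def cis_conv_exp by (intro continuous_intros)
  have int: "set_integrable lborel {-pi..pi} (f n)" for n
    by (rule borel_integrable_atLeastAtMost') (rule cont)
  have val: "(LINT \<theta>:{-pi..pi}|lborel. f n \<theta>) = of_real (\<kappa> ^ n / fact n * A n)" for n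
  proof -
    have "(LINT \<theta>:{-pi..pi}|lborel. f n \<theta>) = integral {-pi..pi} (f n)"
      by (rule set_borel_integral_eq_integral[OF int])
    also have "\<dots> = of_real (\<kappa> ^ n / fact n) *
        (if even (n + p) \<and> p \<le> n then complex_of_real (2 * pi * real (n choose ((n + p) div 2)) / 2 ^ n) else 0)"
      unfolding f_def
      by (intro integral_unique has_integral_mult_right cos_power_moment)
    finally show ?thesis by (simp add: A_def)
  qed
  have nb: "norm (f n \<theta>) \<le> \<bar>\<kappa>\<bar> ^ n / fact n" for n \<theta>
  proof -
    have "norm (f n \<theta>) = \<bar>\<kappa>\<bar> ^ n / fact n * \<bar>cos \<theta>\<bar> ^ n"
      by (simp add: f_def norm_mult norm_power norm_divide power_abs)
    also have "\<dots> \<le> \<bar>\<kappa>\<bar> ^ n / fact n * 1"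
      by (intro mult_left_mono power_le_one) auto
    finally show ?thesis by simp
  qed
  have sk: "summable (\<lambda>n. \<bar>\<kappa>\<bar> ^ n / fact n)"
    using summable_exp[of "\<bar>\<kappa>\<bar>"] by (simp add: field_simps)
  have fs: "(\<lambda>n. f n \<theta>) sums (complex_of_real (exp (\<kappa> * cos \<theta>)) * cis (real p * \<theta>))" for \<theta>
  proof -
    have "(\<lambda>n. complex_of_real ((\<kappa> * cos \<theta>) ^ n /\<^sub>R fact n) * cis (real p * \<theta>)) sums
          (complex_of_real (exp (\<kappa> * cos \<theta>)) * cis (real p * \<theta>))"
      by (intro sums_mult2 sums_of_real exp_converges)
    then show ?thesis by (simp add: f_def power_mult_distrib field_simps)
  qed
  define F where "F n \<theta> = indicator {-pi..pi} \<theta> *\<^sub>R f n \<theta>" for n \<theta>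
  have Fint: "integrable lborel (F n)" for n
    using int unfolding set_integrable_def F_def .
  have Fsum: "summable (\<lambda>n. norm (F n \<theta>))" for \<theta>
    by (rule summable_comparison_test'[OF sk, of 0]) (use nb in \<open>auto simp: F_def indicator_def\<close>)
  have Fsum2: "summable (\<lambda>n. LINT \<theta>|lborel. norm (F n \<theta>))"
  proof (rule summable_comparison_test'[of "\<lambda>n. (\<bar>\<kappa>\<bar> ^ n / fact n) * (2 * pi)" 0])
    show "summable (\<lambda>n. (\<bar>\<kappa>\<bar> ^ n / fact n) * (2 * pi))" by (intro summable_mult2 sk)
    fix n :: nat
    have "(LINT \<theta>|lborel. norm (F n \<theta>)) \<le> (LINT \<theta>|lborel. (\<bar>\<kappa>\<bar> ^ n / fact n) * indicator {-pi..pi} \<theta>)"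
    proof (intro integral_mono integrable_norm Fint)
      show "integrable lborel (\<lambda>\<theta>. (\<bar>\<kappa>\<bar> ^ n / fact n) * indicator {-pi..pi} \<theta>)"
        by (intro integrable_mult_right) auto
      show "norm (F n \<theta>) \<le> (\<bar>\<kappa>\<bar> ^ n / fact n) * indicator {-pi..pi} \<theta>" for \<theta>
        using nb[of n \<theta>] by (auto simp: F_def indicator_def)
    qed
    also have "\<dots> = (\<bar>\<kappa>\<bar> ^ n / fact n) * (2 * pi)" by simp
    finally show "norm (LINT \<theta>|lborel. norm (F n \<theta>)) \<le> (\<bar>\<kappa>\<bar> ^ n / fact n) * (2 * pi)"
      by simp
  qed
  have Fsums: "(\<lambda>n. F n \<theta>) sums (indicator {-pi..pi} \<theta> *\<^sub>R (complex_of_real (exp (\<kappa> * cos \<theta>)) * cis (real p * \<theta>)))" for \<theta>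
    unfolding F_def by (intro sums_scaleR_right fs)
  have Feq: "(\<lambda>\<theta>. \<Sum>n. F n \<theta>) = (\<lambda>\<theta>. indicator {-pi..pi} \<theta> *\<^sub>R (complex_of_real (exp (\<kappa> * cos \<theta>)) * cis (real p * \<theta>)))"
    using Fsums by (auto simp: sums_iff)
  show "set_integrable lborel {-pi..pi} (\<lambda>\<theta>. complex_of_real (exp (\<kappa> * cos \<theta>)) * cis (real p * \<theta>))"
    unfolding set_integrable_def Feq[symmetric]
    by (rule integrable_suminf[OF Fint _ Fsum2]) (use Fsum in auto)
  have "(\<lambda>n. integral\<^sup>L lborel (F n)) sums (LINT \<theta>|lborel. (\<Sum>n. F n \<theta>))"
    by (rule sums_integral[OF Fint _ Fsum2]) (use Fsum in auto)
  then have 1: "(\<lambda>n. complex_of_real (\<kappa> ^ n / fact n * A n)) sums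
     (LINT \<theta>:{-pi..pi}|lborel. complex_of_real (exp (\<kappa> * cos \<theta>)) * cis (real p * \<theta>))" (is "_ sums ?I")
    using val unfolding Feq by (simp only: set_lebesgue_integral_def F_def[abs_def])
  then have "(\<lambda>k. complex_of_real (\<kappa> ^ (2 * k + p) / fact (2 * k + p) * A (2 * k + p))) sums ?I"
  proof (subst sums_mono_reindex)
    show "strict_mono (\<lambda>k. 2 * k + p)" by (simp add: strict_mono_def)
    fix n assume n: "n \<notin> range (\<lambda>k. 2 * k + p)"
    have "\<not> (even (n + p) \<and> p \<le> n)"
    proof
      assume a: "even (n + p) \<and> p \<le> n"
      then have "n = 2 * ((n - p) div 2) + p" by presburger
      then show False using n by blast
    qed
    then show "complex_of_real (\<kappa> ^ n / fact n * A n) = 0" by (auto simp: A_def)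
  qed
  moreover have "\<kappa> ^ (2 * k + p) / fact (2 * k + p) * A (2 * k + p) =
      2 * pi * ((\<kappa> / 2) ^ (2 * k + p) / (fact k * fact (k + p)))" for k
  proof -
    have "(2 * k + p + p) div 2 = k + p" by simp
    moreover have "real ((2 * k + p) choose (k + p)) = fact (2 * k + p) / (fact (k + p) * fact k)"
      by (subst binomial_fact) auto
    ultimately show ?thesis by (simp add: A_def power_divide add.commute[of p k] mult_ac)
  qed
  ultimately have 2: "(\<lambda>k. complex_of_real (2 * pi * ((\<kappa> / 2) ^ (2 * k + p) / (fact k * fact (k + p))))) sums ?I"
    by (simp only:)
  from sums_Re[OF 2] have "(\<lambda>k. 2 * pi * ((\<kappa> / 2) ^ (2 * k + p) / (fact k * fact (k + p)))) sums Re ?I"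
    by (simp only: Re_complex_of_real)
  then have "(\<lambda>k. (\<kappa> / 2) ^ (2 * k + p) / (fact k * fact (k + p))) sums (Re ?I / (2 * pi))"
    by (rule sums_mult_D) simp
  then have "Re ?I = 2 * pi * bessel_I p \<kappa>"
    by (simp add: bessel_I_def sums_iff)
  moreover from sums_Im[OF 2] have "Im ?I = 0"
    by (simp only: Im_complex_of_real sums_iff suminf_zero)
  ultimately show "?I = of_real (2 * pi * bessel_I p \<kappa>)"
    by (simp add: complex_eq_iff)
qed

lemma bessel_I_0_pos: "bessel_I 0 x > 0"
proof -
  have s: "summable (\<lambda>k. (x / 2) ^ (2 * k + 0) / (fact k * fact (k + 0)))"
  proof (rule summable_comparison_test'[OF summable_exp_generic[of "(x / 2)\<^sup>2"], of 0])
    fix k :: nat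
    have "norm ((x / 2) ^ (2 * k + 0) / (fact k * fact (k + 0))) = ((x / 2)\<^sup>2) ^ k / (fact k * fact k)"
      by (simp only: add_0_right power_mult) (subst real_norm_def, rule abs_of_nonneg, intro divide_nonneg_nonneg, auto)
    also have "\<dots> \<le> ((x / 2)\<^sup>2) ^ k / (fact k * 1)"
      by (intro divide_left_mono mult_left_mono) auto
    also have "\<dots> = ((x / 2)\<^sup>2) ^ k /\<^sub>R fact k"
      by (simp only: mult_1_right mult_1_left real_scaleR_def divide_inverse mult.commute)
    finally show "norm ((x / 2) ^ (2 * k + 0) / (fact k * fact (k + 0))) \<le> ((x / 2)\<^sup>2) ^ k /\<^sub>R fact k" .
  qed
  show ?thesis unfolding bessel_I_def
    by (rule suminf_pos2[OF s, of 0]) auto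
qed

theorem von_mises_circular_moment:
  "prob_space (von_mises \<kappa>)"
  "(LINT \<theta>|von_mises \<kappa>. cis (real p * \<theta>)) = complex_of_real (circ_moment \<kappa> p)"
proof -
  define h where "h \<theta> = indicator {-pi..pi} \<theta> * (exp (\<kappa> * cos \<theta>) / (2 * pi * bessel_I 0 \<kappa>))" for \<theta>
  have h_meas [measurable]: "h \<in> borel_measurable borel" unfolding h_def by measurable
  have h_nonneg: "h \<theta> \<ge> 0" for \<theta>
    using bessel_I_0_pos[of \<kappa>] by (simp add: h_def)
  have cm: "(\<lambda>\<theta>. cis (real p * \<theta>)) \<in> borel_measurable borel" for p
    unfolding cis_conv_exp by (intro borel_measurable_continuous_onI continuous_intros)
  have vm: "von_mises \<kappa> = density lborel (\<lambda>\<theta>. ennreal (h \<theta>))"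
    by (simp add: von_mises_def h_def)
  have *: "h \<theta> *\<^sub>R cis (real p * \<theta>) = (1 / complex_of_real (2 * pi * bessel_I 0 \<kappa>)) *
      (indicator {-pi..pi} \<theta> *\<^sub>R (complex_of_real (exp (\<kappa> * cos \<theta>)) * cis (real p * \<theta>)))" for p \<theta>
    by (simp add: h_def scaleR_conv_of_real)
  have I: "integrable lborel (\<lambda>\<theta>. h \<theta> *\<^sub>R cis (real p * \<theta>))"
    and V: "(LINT \<theta>|lborel. h \<theta> *\<^sub>R cis (real p * \<theta>)) = complex_of_real (circ_moment \<kappa> p)" for p
  proof -
    show "integrable lborel (\<lambda>\<theta>. h \<theta> *\<^sub>R cis (real p * \<theta>))"
      unfolding * using von_mises_integral(1)[of \<kappa> p]
      by (intro integrable_mult_right) (simp add: set_integrable_def)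
    have "(LINT \<theta>|lborel. h \<theta> *\<^sub>R cis (real p * \<theta>)) =
        (1 / complex_of_real (2 * pi * bessel_I 0 \<kappa>)) * of_real (2 * pi * bessel_I p \<kappa>)"
      unfolding * integral_mult_right_zero
      using von_mises_integral(2)[of \<kappa> p] by (simp only: set_lebesgue_integral_def)
    then show "(LINT \<theta>|lborel. h \<theta> *\<^sub>R cis (real p * \<theta>)) = complex_of_real (circ_moment \<kappa> p)"
      using bessel_I_0_pos[of \<kappa>] by (simp add: circ_moment_def)
  qed
  show "(LINT \<theta>|von_mises \<kappa>. cis (real p * \<theta>)) = complex_of_real (circ_moment \<kappa> p)"
    unfolding vm using cm by (subst integral_density) (auto simp: h_nonneg V)
  have hi: "integrable lborel (\<lambda>\<theta>. complex_of_real (h \<theta>))"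
    using I[of 0] by (simp add: scaleR_conv_of_real)
  have "(LINT \<theta>|lborel. complex_of_real (h \<theta>)) = 1"
    using V[of 0] bessel_I_0_pos[of \<kappa>] by (simp add: scaleR_conv_of_real circ_moment_def)
  then have "(LINT \<theta>|lborel. h \<theta>) = 1"
    by (metis integral_complex_of_real of_real_eq_1_iff)
  moreover have "integrable lborel h" using integrable_Re[OF hi] by simp
  ultimately have "(\<integral>\<^sup>+\<theta>. ennreal (h \<theta>) \<partial>lborel) = 1"
    by (subst nn_integral_eq_integral) (auto simp: h_nonneg)
  then show "prob_space (von_mises \<kappa>)"
    unfolding vm by (intro prob_spaceI) (simp add: emeasure_density)
qed

end

theory Submission
  imports Defs
begin

text \<open>The maximal gain is almost surely positive, and on positive gains both SINRs exceed their
  thresholds iff the gain exceeds \<open>th\<close>. Hence the outage event is almost surely that all port gains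
  are at most \<open>th\<close>, whose probability the copula gives from the Gamma CDF at \<open>th\<close>. The Gamma
  parameter \<open>m\<close> is positive because \<open>cos \<Theta>\<close> has positive variance under the von Mises law.\<close>

text \<open>All terms of the power series are positive, so only convergence is at stake. Bounding
  one factorial below by 1 leaves \<open>y ^ p\<close> times the exponential series of
  \<open>y\<^sup>2\<close>.\<close>

lemma bessel_I_pos:
  assumes "x > 0"
  shows "bessel_I p x > 0"
proof -
  define y where "y = x / 2"
  have y: "y > 0" using assms by (simp add: y_def)
  have "summable (\<lambda>k. y ^ (2 * k + p) / (fact k * fact (k + p)))"
  proof (rule summable_comparison_test'[of "\<lambda>k. y ^ p * ((y\<^sup>2) ^ k /\<^sub>R fact k)" 0])
    show "summable (\<lambda>k. y ^ p * ((y\<^sup>2) ^ k /\<^sub>R fact k))"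
      by (intro summable_mult summable_exp_generic)
    fix k :: nat
    have "norm (y ^ (2 * k + p) / (fact k * fact (k + p))) = y ^ (2 * k + p) / (fact k * fact (k + p))"
      using y by simp
    also have "\<dots> \<le> y ^ (2 * k + p) / (fact k * 1)"
      using y by (intro divide_left_mono mult_left_mono) auto
    also have "\<dots> = y ^ p * ((y\<^sup>2) ^ k /\<^sub>R fact k)"
      unfolding power_add power_mult by (simp add: divide_inverse)
    finally show "norm (y ^ (2 * k + p) / (fact k * fact (k + p))) \<le> y ^ p * ((y\<^sup>2) ^ k /\<^sub>R fact k)" .
  qed
  then show ?thesis
    unfolding bessel_I_def y_def[symmetric] using y by (intro suminf_pos) auto
qed

text \<open>Real part of the complex circular moment; integrability comes from boundedness on a
  probability space.\<close>

lemma von_mises_cos_moment: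
  shows "integrable (von_mises \<kappa>) (\<lambda>\<theta>. cos (real p * \<theta>))"
    and "(LINT \<theta>|von_mises \<kappa>. cos (real p * \<theta>)) = circ_moment \<kappa> p"
proof -
  interpret V: prob_space "von_mises \<kappa>" by (rule von_mises_circular_moment)
  have [measurable_cong]: "sets (von_mises \<kappa>) = sets borel" by (simp add: von_mises_def)
  have "(\<lambda>\<theta>. cis (real p * \<theta>)) \<in> borel_measurable borel"
    unfolding cis_conv_exp by (intro borel_measurable_continuous_onI continuous_intros)
  then have "integrable (von_mises \<kappa>) (\<lambda>\<theta>. cis (real p * \<theta>))"
    by (intro V.integrable_const_bound[of _ 1]) auto
  note Re = integrable_Re[OF this] integral_Re[OF this]
  show "integrable (von_mises \<kappa>) (\<lambda>\<theta>. cos (real p * \<theta>))"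
    using Re(1) by simp
  show "(LINT \<theta>|von_mises \<kappa>. cos (real p * \<theta>)) = circ_moment \<kappa> p"
    using Re(2) by (simp add: von_mises_circular_moment(2))
qed

text \<open>The density is positive on the whole of \<open>{-pi..pi}\<close>, so the equation would
  hold at Lebesgue-almost every point there. But cosine is injective on
  \<open>{0..pi}\<close>.\<close>

lemma von_mises_not_AE_cos_const: "\<not> (AE \<theta> in von_mises \<kappa>. cos \<theta> = c)"
proof
  have b: "bessel_I 0 \<kappa> > 0" by (rule bessel_I_0_pos)
  assume "AE \<theta> in von_mises \<kappa>. cos \<theta> = c"
  then have "AE \<theta> in lborel. \<theta> \<in> {-pi..pi} \<longrightarrow> cos \<theta> = c"
    unfolding von_mises_def
    by (subst (asm) AE_density) (use b in \<open>auto simp: indicator_def elim!: eventually_mono\<close>)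
  \<comment> \<open>\<open>arccos c\<close> is the only point of \<open>{0..pi}\<close> at which the
    cosine could equal \<open>c\<close>; discarding it makes \<open>{0..pi}\<close> a null
    set.\<close>
  moreover have "AE \<theta> in lborel. \<theta> \<noteq> arccos c"
    by (rule AE_lborel_singleton)
  ultimately have "AE \<theta> in lborel. \<theta> \<notin> {0..pi}"
  proof eventually_elim
    case (elim \<theta>)
    then show ?case using arccos_cos[of \<theta>] pi_gt_zero by auto
  qed
  then have "emeasure lborel {0..pi} = 0"
    by (subst (asm) AE_iff_measurable[of "{0..pi}"]) auto
  then show False by simp
qed

text \<open>The difference of the two sides is twice the variance of \<open>cos \<Theta>\<close>.\<close>

lemma circ_moment_variance: "2 * (circ_moment \<kappa> 1)\<^sup>2 < 1 + circ_moment \<kappa> 2"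
proof -
  interpret V: prob_space "von_mises \<kappa>" by (rule von_mises_circular_moment)
  let ?c = "circ_moment \<kappa> 1"
  \<comment> \<open>\<open>?h\<close> is the square expanded by the double-angle formula, so its
    expectation involves only the first two circular moments.\<close>
  let ?h = "\<lambda>\<theta>. 1 / 2 + cos (2 * \<theta>) / 2 - 2 * ?c * cos \<theta> + ?c\<^sup>2 :: real"
  have eq: "(cos \<theta> - ?c)\<^sup>2 = ?h \<theta>" for \<theta>
    unfolding cos_double_cos by (simp add: power2_eq_square field_simps)
  have i1: "integrable (von_mises \<kappa>) cos" "V.expectation cos = ?c"
    using von_mises_cos_moment[of \<kappa> 1] by simp_all
  have i2: "integrable (von_mises \<kappa>) (\<lambda>\<theta>. cos (2 * \<theta>))"
    "V.expectation (\<lambda>\<theta>. cos (2 * \<theta>)) = circ_moment \<kappa> 2"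
    using von_mises_cos_moment[of \<kappa> 2] by simp_all
  have int: "integrable (von_mises \<kappa>) (\<lambda>\<theta>. (cos \<theta> - ?c)\<^sup>2)"
    unfolding eq using i1 i2 by auto
  have "V.expectation (\<lambda>\<theta>. (cos \<theta> - ?c)\<^sup>2) = 1 / 2 + circ_moment \<kappa> 2 / 2 - 2 * ?c * ?c + ?c\<^sup>2"
    unfolding eq using i1 i2 by (simp add: V.prob_space)
  moreover have "V.expectation (\<lambda>\<theta>. (cos \<theta> - ?c)\<^sup>2) \<noteq> 0"
    using von_mises_not_AE_cos_const[of ?c \<kappa>]
    by (subst integral_nonneg_eq_0_iff_AE[OF int]) auto
  moreover have "V.expectation (\<lambda>\<theta>. (cos \<theta> - ?c)\<^sup>2) \<ge> 0"
    by (intro integral_nonneg_AE) auto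
  ultimately show ?thesis by (simp add: power2_eq_square)
qed

text \<open>Substitute \<open>z = m * g / gbar\<close> in the incomplete Gamma integral.\<close>

lemma gamma_density_has_integral:
  assumes "m > 0" "gbar > 0" "x \<ge> 0"
  shows "(gamma_density m gbar has_integral (1 / Gamma m * lower_inc_gamma m (m * x / gbar))) {0..x}"
proof -
  define c where "c = m / gbar"
  have c: "c > 0" using assms by (simp add: c_def)
  let ?f = "\<lambda>z::real. z powr (m - 1) * exp (- z)"
  \<comment> \<open>For \<open>m < 1\<close> the integrand is unbounded near 0, so integrability is
    inherited from the complete Gamma integral rather than from continuity.\<close>
  have "?f integrable_on {0..}"
    using Gamma_integral_real[of m] assms(1)
    by (auto simp: exp_minus divide_inverse integrable_on_def)
  then have "?f integrable_on {0..m * x / gbar}"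
    by (rule integrable_on_subinterval) auto
  then have "(?f has_integral lower_inc_gamma m (m * x / gbar)) {0..c * x}"
    by (simp add: lower_inc_gamma_def c_def integrable_integral)
  from has_integral_stretch_real[OF this, of c] c
  have "((\<lambda>g. ?f (c * g)) has_integral (1 / c * lower_inc_gamma m (m * x / gbar))) {0..x}"
    by (simp add: image_divide_atLeastAtMost)
  from has_integral_mult_right[OF this, of "c / Gamma m"]
  have "((\<lambda>g. c / Gamma m * ?f (c * g)) has_integral (1 / Gamma m * lower_inc_gamma m (m * x / gbar))) {0..x}"
    using c by simp
  then show ?thesis
  proof (rule has_integral_eq[rotated])
    fix g assume "g \<in> {0..x}"
    \<comment> \<open>At \<open>g = 0\<close> the left side vanishes because
      \<open>0 powr x = 0\<close>, and the density is 0 there by definition.\<close>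
    then consider "g = 0" | "g > 0" by fastforce
    then show "c / Gamma m * ?f (c * g) = gamma_density m gbar g"
    proof cases
      case 2
      have "c * c powr (m - 1) = c powr m"
        using powr_add[of c 1 "m - 1"] c by simp
      then have "c / Gamma m * ?f (c * g) = c powr m / Gamma m * g powr (m - 1) * exp (- (c * g))"
        using 2 c by (simp add: powr_mult field_simps)
      then show ?thesis
        using 2 assms by (simp add: gamma_density_def c_def powr_divide mult.commute)
    qed (simp add: gamma_density_def)
  qed
qed

lemma gamma_density_nonneg: "m > 0 \<Longrightarrow> gamma_density m gbar x \<ge> 0"
  by (simp add: gamma_density_def Gamma_real_nonneg)

text \<open>The density vanishes on the negative half-line, so the mass of \<open>{..x}\<close> is
  the integral over \<open>{0..x}\<close>.\<close>

lemma (in prob_space) gamma_cdf: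
  assumes X: "distributed M lborel X (\<lambda>x. ennreal (gamma_density m gbar x))"
    and "m > 0" "gbar > 0" "x \<ge> 0"
  shows "cdf (distr M borel X) x = 1 / Gamma m * lower_inc_gamma m (m * x / gbar)"
proof -
  let ?I = "1 / Gamma m * lower_inc_gamma m (m * x / gbar)"
  have hi: "(gamma_density m gbar has_integral ?I) {0..x}"
    using assms(2-4) by (rule gamma_density_has_integral)
  have nn: "gamma_density m gbar y \<ge> 0" for y
    using assms(2) by (rule gamma_density_nonneg)
  have [measurable]: "X \<in> borel_measurable M"
    using distributed_measurable[OF X] by simp
  have "emeasure M (X -` {..x} \<inter> space M) = (\<integral>\<^sup>+y. ennreal (gamma_density m gbar y) * indicator {..x} y \<partial>lborel)"
    by (rule distributed_emeasure[OF X]) simp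
  also have "\<dots> = (\<integral>\<^sup>+y. ennreal (gamma_density m gbar y) * indicator {0..x} y \<partial>lborel)"
    by (intro nn_integral_cong) (auto simp: indicator_def gamma_density_def)
  also have "\<dots> = ennreal ?I"
    using nn_integral_has_integral_lebesgue'[OF _ hi] nn by simp
  \<comment> \<open>Leaving \<open>ennreal\<close> requires \<open>?I\<close> to be nonnegative,
    since \<open>ennreal\<close> sends negative reals to 0.\<close>
  finally have "prob (X -` {..x} \<inter> space M) = ?I"
    using has_integral_nonneg[OF hi] nn by (simp add: emeasure_eq_measure)
  then show ?thesis by (simp add: cdf_def measure_distr)
qed

lemma (in prob_space) gamma_AE_pos:
  assumes "distributed M lborel X (\<lambda>x. ennreal (gamma_density m gbar x))"
  shows "AE \<omega> in M. X \<omega> > 0"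
proof -
  have "AE x in density lborel (\<lambda>x. ennreal (gamma_density m gbar x)). x > 0"
    using distributed_borel_measurable[OF assms]
    by (subst AE_density) (auto simp: gamma_density_def)
  then have "AE x in distr M lborel X. x > 0"
    by (simp only: distributed_distr_eq_density[OF assms])
  then show ?thesis
    by (rule AE_distrD[OF distributed_measurable[OF assms]])
qed

text \<open>Clearing the positive denominator makes the inequality linear in \<open>G\<close>. As
  \<open>G\<close> grows the ratio approaches \<open>a / b\<close> from below;
  \<open>b * t < a\<close> puts \<open>t\<close> below this limit and makes the final divisor
  positive.\<close>

lemma sinr_gt_iff:
  fixes c :: real
  assumes "c > 0" "b > 0" "G > 0" "b * t < a"
  shows "c * a * G / (c * b * G + 1) > t \<longleftrightarrow> G > t / (c * (a - b * t))"
proof -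
  have "c * b * G > 0" using assms by simp
  then have "c * b * G + 1 > 0" by linarith
  then have "c * a * G / (c * b * G + 1) > t \<longleftrightarrow> t * (c * b * G + 1) < c * a * G"
    by (simp add: pos_less_divide_eq)
  also have "\<dots> \<longleftrightarrow> t < G * (c * (a - b * t))"
    by (simp add: algebra_simps)
  also have "\<dots> \<longleftrightarrow> G > t / (c * (a - b * t))"
    using assms by (simp add: pos_divide_less_eq)
  finally show ?thesis .
qed

theorem proposition2:
  fixes M :: "'a measure"
    and u :: user
    and g :: "'n::finite \<Rightarrow> 'a \<Rightarrow> real"
    and S :: "real ^ 'n ^ 'n"
    and \<nu> \<kappa> \<beta> a_b a_u a_tilde m gbar :: real
    and K :: nat
    and snr L \<alpha>_c :: real
    and \<alpha>_p :: "user \<Rightarrow> real"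
    and th_c th_p th_c_hat th_p_hat th :: real
    and g_fas \<gamma>_c \<gamma>_p :: "'a \<Rightarrow> real"
  assumes prob: "prob_space M"
    \<comment> \<open>channel parameters\<close>
    and K: "K \<ge> 1"
    and \<beta>: "0 < \<beta>" "\<beta> \<le> 1"
    and \<kappa>: "\<kappa> > 0"
    and a_b: "0 < a_b" "a_b \<le> 1"
    and a_u: "0 < a_u" "a_u \<le> 1"
    and a_tilde: "a_tilde = sqrt (a_b * a_u)"
    and gbar: "gbar = \<beta>\<^sup>2 * (circ_moment \<kappa> 1)\<^sup>2 * a_tilde ^ 4"
    and m: "m = real K / 2 * ((circ_moment \<kappa> 1)\<^sup>2 * a_tilde ^ 4
                 / (1 + circ_moment \<kappa> 2 - 2 * (circ_moment \<kappa> 1)\<^sup>2 * a_tilde ^ 4))"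
    \<comment> \<open>port gains\<close>
    and \<nu>: "\<nu> > 0"
    and S: "correlation_matrix S" "pos_definite S"
    and marginals: "\<And>n. distributed M lborel (g n) (\<lambda>x. ennreal (gamma_density m gbar x))"
    and copula: "prob_space.has_copula M g (student_t_copula \<nu> S)"
    and g_fas: "\<And>\<omega>. g_fas \<omega> = Max (range (\<lambda>n. g n \<omega>))"
    \<comment> \<open>signalling\<close>
    and snr: "snr > 0"
    and L: "L > 0"
    and \<alpha>: "\<alpha>_c > 0" "\<alpha>_p Reflection > 0" "\<alpha>_p Transmission > 0" "\<alpha>_c + \<alpha>_p Reflection + \<alpha>_p Transmission = 1"
    and \<gamma>_c: "\<And>\<omega>. \<gamma>_c \<omega> = snr * \<alpha>_c * L * (real K)\<^sup>2 * g_fas \<omega>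
                       / (snr * (\<alpha>_p Reflection + \<alpha>_p Transmission) * L * (real K)\<^sup>2 * g_fas \<omega> + 1)"
    and \<gamma>_p: "\<And>\<omega>. \<gamma>_p \<omega> = snr * \<alpha>_p u * L * (real K)\<^sup>2 * g_fas \<omega>
                       / (snr * \<alpha>_p (other u) * L * (real K)\<^sup>2 * g_fas \<omega> + 1)"
    \<comment> \<open>thresholds\<close>
    and th_c: "0 < th_c" "th_c < \<alpha>_c / (1 - \<alpha>_c)"
    and th_p: "0 < th_p" "th_p < \<alpha>_p u / (1 - \<alpha>_c - \<alpha>_p u)"
    and th_c_hat: "th_c_hat = th_c / (snr * L * (real K)\<^sup>2 * (\<alpha>_c - (\<alpha>_p Reflection + \<alpha>_p Transmission) * th_c))"
    and th_p_hat: "th_p_hat = th_p / (snr * L * (real K)\<^sup>2 * (\<alpha>_p u - \<alpha>_p (other u) * th_p))"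
    and th: "th = max th_c_hat th_p_hat"
  shows "1 - \<P>(\<omega> in M. \<gamma>_c \<omega> > th_c \<and> \<gamma>_p \<omega> > th_p)
       = mv_student_t_cdf \<nu> S
           (\<chi> n. student_t_quantile \<nu> (1 / Gamma m * lower_inc_gamma m (m * th / gbar)))"
proof -
  interpret prob_space M by (rule prob)
  define \<phi> where "\<phi> = circ_moment \<kappa> 1"
  have \<phi>: "\<phi> > 0"
    using \<kappa> by (simp add: \<phi>_def circ_moment_def bessel_I_pos)
  have a0: "a_tilde > 0" using a_b a_u by (simp add: a_tilde)
  have a1: "a_tilde ^ 4 \<le> 1"
    using a_b a_u by (intro power_le_one) (auto simp: a_tilde mult_le_one)
  have gbar_pos: "gbar > 0" using \<beta> \<phi> a0 by (simp add: gbar \<phi>_def)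
  \<comment> \<open>Since \<open>a_tilde ^ 4\<close> is at most 1, the variance inequality still
    gives a positive denominator in \<open>m\<close>.\<close>
  have "2 * \<phi>\<^sup>2 * a_tilde ^ 4 \<le> 2 * \<phi>\<^sup>2" using a1 by (intro mult_left_le) auto
  also have "\<dots> < 1 + circ_moment \<kappa> 2" unfolding \<phi>_def by (rule circ_moment_variance)
  finally have m_pos: "m > 0" using K \<phi> a0 by (simp add: m \<phi>_def)

  define c where "c = snr * L * (real K)\<^sup>2"
  have c: "c > 0" using snr L K by (simp add: c_def)
  define b where "b = \<alpha>_p Reflection + \<alpha>_p Transmission"
  have b: "b > 0" "b = 1 - \<alpha>_c" using \<alpha> by (auto simp: b_def)
  have other: "\<alpha>_p (other u) > 0" "\<alpha>_p (other u) = 1 - \<alpha>_c - \<alpha>_p u"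
    using \<alpha> by (cases u; simp)+
  \<comment> \<open>Because the power factors sum to 1, the denominators in the threshold hypotheses
    are the interfering powers \<open>b\<close> and \<open>\<alpha>_p (other u)\<close>. Both
    hypotheses thus become the last premise of \<open>sinr_gt_iff\<close>.\<close>
  have lt_c: "b * th_c < \<alpha>_c" using th_c b by (simp add: pos_less_divide_eq mult.commute)
  have lt_p: "\<alpha>_p (other u) * th_p < \<alpha>_p u"
    using th_p other by (simp add: pos_less_divide_eq mult.commute)
  \<comment> \<open>Positivity of \<open>th\<close> places it in the range where
    \<open>gamma_cdf\<close> applies.\<close>
  have "th_c_hat > 0" using th_c c lt_c by (simp add: th_c_hat c_def b_def)
  then have th_pos: "th > 0" by (simp add: th)

  have [measurable]: "g n \<in> borel_measurable M" for n
    using distributed_measurable[OF marginals[of n]] by simp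
  have g_fas_le: "g_fas \<omega> \<le> x \<longleftrightarrow> (\<forall>n. g n \<omega> \<le> x)" for \<omega> x
    by (auto simp: g_fas)
  \<comment> \<open>Sublevel sets of the maximum are finite intersections of sublevel sets of the
    port gains.\<close>
  have [measurable]: "g_fas \<in> borel_measurable M"
    unfolding borel_measurable_iff_le g_fas_le by measurable
  have [measurable]: "\<gamma>_c \<in> borel_measurable M" "\<gamma>_p \<in> borel_measurable M"
    unfolding \<gamma>_c[abs_def] \<gamma>_p[abs_def] by measurable

  \<comment> \<open>\<open>undefined\<close> serves as an arbitrary port: one positive gain already
    makes the maximum positive.\<close>
  have "AE \<omega> in M. g undefined \<omega> > 0"
    by (rule gamma_AE_pos[OF marginals])
  then have "AE \<omega> in M. \<not> (\<gamma>_c \<omega> > th_c \<and> \<gamma>_p \<omega> > th_p) \<longleftrightarrow> (\<forall>n. g n \<omega> \<le> th)"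
  proof eventually_elim
    case (elim \<omega>)
    have G: "g_fas \<omega> > 0"
      using elim g_fas_le[of \<omega> "g_fas \<omega>"] by (meson less_le_trans order_refl)
    have "\<gamma>_c \<omega> > th_c \<longleftrightarrow> g_fas \<omega> > th_c_hat"
      using sinr_gt_iff[OF c b(1) G lt_c] by (simp add: \<gamma>_c th_c_hat c_def b_def mult_ac)
    moreover have "\<gamma>_p \<omega> > th_p \<longleftrightarrow> g_fas \<omega> > th_p_hat"
      using sinr_gt_iff[OF c other(1) G lt_p] by (simp add: \<gamma>_p th_p_hat c_def mult_ac)
    ultimately show ?case
      by (simp add: th flip: g_fas_le) linarith
  qed
  then have "\<P>(\<omega> in M. \<not> (\<gamma>_c \<omega> > th_c \<and> \<gamma>_p \<omega> > th_p)) = \<P>(\<omega> in M. \<forall>n. g n \<omega> \<le> th)"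
    by (intro prob_eq_AE) auto
  moreover have "\<P>(\<omega> in M. \<not> (\<gamma>_c \<omega> > th_c \<and> \<gamma>_p \<omega> > th_p)) = 1 - \<P>(\<omega> in M. \<gamma>_c \<omega> > th_c \<and> \<gamma>_p \<omega> > th_p)"
    by (intro prob_neg) measurable
  moreover have "\<P>(\<omega> in M. \<forall>n. g n \<omega> \<le> th)
      = student_t_copula \<nu> S (\<chi> n. cdf (distr M borel (g n)) th)"
    using copula[unfolded has_copula_def, rule_format, of "\<chi> n. th"] by simp
  moreover have "cdf (distr M borel (g n)) th = 1 / Gamma m * lower_inc_gamma m (m * th / gbar)" for n
    using th_pos by (intro gamma_cdf marginals m_pos gbar_pos) simp
  ultimately show ?thesis
    by (simp add: student_t_copula_def)
qed

end
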